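(* Let $c\neq 0$ and $\lambda>0$ be real constants, let $I\subset\mathbb{R}$ be an open interval on which $\cos\left(\frac{u}{c}\right)\neq0$ and $1-\frac{\lambda^2}{c^2}\sin^2\left(\frac{u}{c}\right)>0$, and let $\rho=\rho(v)$ be a smooth curve parametrized by arclength on the unit sphere $S^2$ of the subspace $\mathbb{E}^3=\mathrm{span}\{e_2,e_3,e_4\}$ of $\mathbb{E}^4$, where $e_1,\dots,e_4$ is the standard orthonormal basis of $\mathbb{E}^4$. Let $M$ be the (meridian) surface in $\mathbb{E}^4$ given by $$X(u,v)=\phi(u)\,e_1+\lambda\cos\left(\tfrac uc\right)\rho(v),\qquad \phi(u)=\int\sqrt{1-\tfrac{\lambda^2}{c^2}\sin^2\left(\tfrac uc\right)}\,du .$$ Then $M$ has Gaussian curvature $$K=-\frac{\kappa_\gamma\,\phi'(u)}{\lambda\cos\left(\frac uc\right)},$$ where $$\kappa_\gamma(u)=-\frac{\lambda}{c^2}\phi'(u)\cos\left(\frac uc\right)+\frac{\lambda}{c}\phi''(u)\sin\left(\frac uc\right).$$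
   Context: For a regular patch in $\mathbb{E}^4$ with $g_{11}=\langle X_u,X_u\rangle$, $g_{12}=\langle X_u,X_v\rangle$, $g_{22}=\langle X_v,X_v\rangle$, $W^2=g_{11}g_{22}-g_{12}^2\neq0$, orthonormal normal frame $N_1,N_2$ and $L_{11}^k=\langle X_{uu},N_k\rangle$, $L_{12}^k=\langle X_{uv},N_k\rangle$, $L_{22}^k=\langle X_{vv},N_k\rangle$, the Gaussian curvature is $K=\frac{1}{W^2}\sum_{k=1}^{2}\left(L_{11}^kL_{22}^k-(L_{12}^k)^2\right)$. The integral defining $\phi$ denotes any antiderivative on $I$. *)

theory Defs
  imports "HOL-Analysis.Analysis"
begin

text \<open>On an open set \<open>S\<close> this is exactly the class of infinitely differentiable curves.\<close>
definition smooth_curve_on :: "real set \<Rightarrow> (real \<Rightarrow> 'a::real_normed_vector) \<Rightarrow> bool" where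
  "smooth_curve_on S f \<longleftrightarrow>
     (\<forall>n. \<forall>t\<in>S. ((\<lambda>g s. vector_derivative g (at s)) ^^ n) f differentiable (at t))"

definition partial_u :: "(real \<Rightarrow> real \<Rightarrow> real^4) \<Rightarrow> real \<Rightarrow> real \<Rightarrow> real^4" where
  "partial_u X u v = vector_derivative (\<lambda>s. X s v) (at u)"

definition partial_v :: "(real \<Rightarrow> real \<Rightarrow> real^4) \<Rightarrow> real \<Rightarrow> real \<Rightarrow> real^4" where
  "partial_v X u v = vector_derivative (\<lambda>t. X u t) (at v)"

definition g11 :: "(real \<Rightarrow> real \<Rightarrow> real^4) \<Rightarrow> real \<Rightarrow> real \<Rightarrow> real" where
  "g11 X u v = partial_u X u v \<bullet> partial_u X u v"

definition g12 :: "(real \<Rightarrow> real \<Rightarrow> real^4) \<Rightarrow> real \<Rightarrow> real \<Rightarrow> real" where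
  "g12 X u v = partial_u X u v \<bullet> partial_v X u v"

definition g22 :: "(real \<Rightarrow> real \<Rightarrow> real^4) \<Rightarrow> real \<Rightarrow> real \<Rightarrow> real" where
  "g22 X u v = partial_v X u v \<bullet> partial_v X u v"

definition W_squared :: "(real \<Rightarrow> real \<Rightarrow> real^4) \<Rightarrow> real \<Rightarrow> real \<Rightarrow> real" where
  "W_squared X u v = g11 X u v * g22 X u v - (g12 X u v)\<^sup>2"

text \<open>In the following, \<open>n\<close> is a normal vector of the surface at the point \<open>X u v\<close>.\<close>
definition L11 :: "(real \<Rightarrow> real \<Rightarrow> real^4) \<Rightarrow> real^4 \<Rightarrow> real \<Rightarrow> real \<Rightarrow> real" where
  "L11 X n u v = partial_u (partial_u X) u v \<bullet> n"

text \<open>The second derivative \<open>X\<^sub>u\<^sub>v\<close> is taken first in \<open>u\<close>, then in \<open>v\<close>.\<close>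
definition L12 :: "(real \<Rightarrow> real \<Rightarrow> real^4) \<Rightarrow> real^4 \<Rightarrow> real \<Rightarrow> real \<Rightarrow> real" where
  "L12 X n u v = partial_v (partial_u X) u v \<bullet> n"

definition L22 :: "(real \<Rightarrow> real \<Rightarrow> real^4) \<Rightarrow> real^4 \<Rightarrow> real \<Rightarrow> real \<Rightarrow> real" where
  "L22 X n u v = partial_v (partial_v X) u v \<bullet> n"

definition orthonormal_normal_frame ::
    "(real \<Rightarrow> real \<Rightarrow> real^4) \<Rightarrow> real \<Rightarrow> real \<Rightarrow> (2 \<Rightarrow> real^4) \<Rightarrow> bool" where
  "orthonormal_normal_frame X u v N \<longleftrightarrow>
     (\<forall>i j. N i \<bullet> N j = (if i = j then 1 else 0)) \<and>
     (\<forall>k. partial_u X u v \<bullet> N k = 0 \<and> partial_v X u v \<bullet> N k = 0)"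

text \<open>
  The curvature formula does not depend on the choice of the frame.  The definition asks for the
  value \<open>K\<close> for every orthonormal frame of the normal plane, and for the existence of
  such a frame at a regular point, so that it never holds vacuously.
\<close>
definition has_gaussian_curvature_at ::
    "(real \<Rightarrow> real \<Rightarrow> real^4) \<Rightarrow> real \<Rightarrow> real \<Rightarrow> real \<Rightarrow> bool" where
  "has_gaussian_curvature_at X K u v \<longleftrightarrow>
     W_squared X u v \<noteq> 0 \<and>
     (\<exists>N. orthonormal_normal_frame X u v N) \<and>
     (\<forall>N. orthonormal_normal_frame X u v N \<longrightarrow>
        K = 1 / W_squared X u v *
              (\<Sum>k\<in>UNIV. L11 X (N k) u v * L22 X (N k) u v - (L12 X (N k) u v)\<^sup>2))"

definition meridian_surface ::
    "real \<Rightarrow> real \<Rightarrow> (real \<Rightarrow> real) \<Rightarrow> (real \<Rightarrow> real^4) \<Rightarrow> real \<Rightarrow> real \<Rightarrow> real^4" where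
  "meridian_surface c lam \<phi> \<rho> u v =
     \<phi> u *\<^sub>R axis 1 1 + (lam * cos (u / c)) *\<^sub>R \<rho> v"

definition kappa_gamma :: "real \<Rightarrow> real \<Rightarrow> (real \<Rightarrow> real) \<Rightarrow> real \<Rightarrow> real" where
  "kappa_gamma c lam \<phi> u =
     - (lam / c\<^sup>2) * deriv \<phi> u * cos (u / c) + (lam / c) * deriv (deriv \<phi>) u * sin (u / c)"

end

theory Submission
  imports Defs
begin

text \<open>
  The profile curve \<open>(f, \<phi>)\<close> with \<open>f u = lam * cos (u / c)\<close> has unit speed, since
  \<open>\<phi>'\<close> is chosen such that \<open>f'\<^sup>2 + \<phi>'\<^sup>2 = 1\<close>.  In the plane spanned by \<open>e\<^sub>1\<close> and
  \<open>\<rho> v\<close> the tangent \<open>X\<^sub>u = \<phi>' e\<^sub>1 + f' \<rho>\<close> is therefore a unit vector, and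
  \<open>n = \<phi>' \<rho> - f' e\<^sub>1\<close> is that vector turned by a right angle.  It is also orthogonal to
  \<open>X\<^sub>v = f \<rho>'\<close>, so it is a normal vector of the surface.  The Frenet equation of the
  profile curve is \<open>X\<^sub>u\<^sub>u = \<kappa> n\<close> with \<open>\<kappa> = \<phi>' f'' - f' \<phi>''\<close>, and this \<open>\<kappa>\<close> is
  \<open>\<kappa>\<^sub>\<gamma>\<close>.  Moreover \<open>X\<^sub>u\<^sub>v = f' \<rho>'\<close> is tangent, so every \<open>L\<^sub>1\<^sub>2\<^sup>k\<close> vanishes.

  Hence the sum in the formula for \<open>K\<close> is \<open>\<kappa> \<Sum>k. (n \<bullet> N\<^sub>k) (X\<^sub>v\<^sub>v \<bullet> N\<^sub>k)\<close>.  As \<open>n\<close> lies in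
  the normal plane, Parseval's identity (\<open>orthonormal_normal_frame_parseval\<close>) turns it into
  \<open>\<kappa> (n \<bullet> X\<^sub>v\<^sub>v) = \<kappa> f \<phi>' (\<rho> \<bullet> \<rho>'')\<close> whatever the frame is, and
  \<open>\<rho> \<bullet> \<rho>'' = - \<rho>' \<bullet> \<rho>' = -1\<close> because \<open>\<rho>\<close> is a unit speed curve on a sphere.
  Division by \<open>W\<^sup>2 = f\<^sup>2\<close> gives \<open>K = - \<kappa> \<phi>' / f\<close>.  Only the unit speed of the profile
  enters, so the computation is carried out in \<open>gaussian_curvature_unit_speed_meridian\<close> for
  an arbitrary profile curve.
\<close>

section \<open>Normal frames of a regular patch\<close>

text \<open>For linearly dependent vectors the Cauchy-Schwarz inequality is an equality.\<close>
lemma gram_determinant_nonzero_independent: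
  fixes a b :: "'a::real_inner"
  assumes "(a \<bullet> a) * (b \<bullet> b) - (a \<bullet> b)\<^sup>2 \<noteq> 0"
  shows "independent {a, b}" and "a \<noteq> b"
proof -
  show ne: "a \<noteq> b"
    using assms by (auto simp: power2_eq_square)
  have "b \<noteq> 0"
    using assms by auto
  moreover have "a \<notin> span {b}"
    using assms by (auto simp: span_singleton power2_eq_square)
  ultimately show "independent {a, b}"
    using ne by (simp add: independent_insert)
qed

definition normal_plane :: "(real \<Rightarrow> real \<Rightarrow> real^4) \<Rightarrow> real \<Rightarrow> real \<Rightarrow> (real^4) set" where
  "normal_plane X u v = {y. \<forall>x \<in> span {partial_u X u v, partial_v X u v}. orthogonal x y}"

lemma mem_normal_plane_iff:
  "y \<in> normal_plane X u v \<longleftrightarrow> partial_u X u v \<bullet> y = 0 \<and> partial_v X u v \<bullet> y = 0"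
proof -
  have "orthogonal x y"
    if "partial_u X u v \<bullet> y = 0" "partial_v X u v \<bullet> y = 0"
      and "x \<in> span {partial_u X u v, partial_v X u v}" for x
  proof -
    have "orthogonal y x"
      by (rule orthogonal_to_span[OF that(3)])
        (use that(1,2) in \<open>auto simp: orthogonal_def inner_commute[of y]\<close>)
    then show ?thesis
      by (simp add: orthogonal_commute)
  qed
  then show ?thesis
    unfolding normal_plane_def by (auto simp: orthogonal_def span_base)
qed

lemma subspace_normal_plane: "subspace (normal_plane X u v)"
  by (rule subspaceI) (auto simp: mem_normal_plane_iff inner_right_distrib)

lemma dim_normal_plane:
  assumes "W_squared X u v \<noteq> 0"
  shows "dim (normal_plane X u v) = 2"
proof -
  let ?a = "partial_u X u v" and ?b = "partial_v X u v"
  have ind: "independent {?a, ?b}" "?a \<noteq> ?b"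
    using gram_determinant_nonzero_independent[of ?a ?b] assms
    by (simp_all add: W_squared_def g11_def g12_def g22_def)
  have "dim (span {?a, ?b}) = 2"
    using ind by (simp add: dim_eq_card_independent)
  moreover have "dim (normal_plane X u v) + dim (span {?a, ?b}) = 4"
    using dim_subspace_orthogonal_to_vectors[of "span {?a, ?b}" "UNIV :: (real^4) set"]
    by (simp add: normal_plane_def)
  ultimately show ?thesis
    by simp
qed

lemma orthonormal_normal_frame_exists:
  assumes "W_squared X u v \<noteq> 0"
  shows "\<exists>N. orthonormal_normal_frame X u v N"
proof -
  obtain B where B: "B \<subseteq> normal_plane X u v" "pairwise orthogonal B"
      "\<And>x. x \<in> B \<Longrightarrow> norm x = 1" "card B = dim (normal_plane X u v)"
    using orthonormal_basis_subspace[OF subspace_normal_plane] by metis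
  then obtain a b where ab: "B = {a, b}" "a \<noteq> b"
    using dim_normal_plane[OF assms] by (metis card_2_iff)
  have "a \<bullet> a = 1" "b \<bullet> b = 1" "a \<bullet> b = 0"
    using B ab by (auto simp: pairwise_def orthogonal_def norm_eq_1)
  moreover have "a \<in> normal_plane X u v" "b \<in> normal_plane X u v"
    using B(1) ab by auto
  ultimately have "orthonormal_normal_frame X u v (\<lambda>k. if k = 1 then a else b)"
    by (auto simp: orthonormal_normal_frame_def mem_normal_plane_iff forall_2 inner_commute)
  then show ?thesis
    by blast
qed

text \<open>
  Two orthonormal vectors in a plane are a basis of it, so a normal vector is recovered from its
  components in the frame.  The tangential part of \<open>w\<close> is orthogonal to \<open>n\<close> and to the
  frame, so it contributes to neither side.
\<close>
lemma orthonormal_normal_frame_parseval: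
  assumes W: "W_squared X u v \<noteq> 0" and N: "orthonormal_normal_frame X u v N"
    and n: "partial_u X u v \<bullet> n = 0" "partial_v X u v \<bullet> n = 0"
  shows "(\<Sum>k\<in>UNIV. (n \<bullet> N k) * (w \<bullet> N k)) = n \<bullet> w"
proof -
  have ip: "N i \<bullet> N j = (if i = j then 1 else 0)" for i j
    using N by (simp add: orthonormal_normal_frame_def)
  have "N 1 \<noteq> N 2"
    using ip[of 1 2] ip[of 1 1] by auto
  moreover have "independent {N 1, N 2}"
    by (rule gram_determinant_nonzero_independent) (simp add: ip)
  moreover have sub: "{N 1, N 2} \<subseteq> normal_plane X u v"
    using N by (auto simp: orthonormal_normal_frame_def mem_normal_plane_iff)
  ultimately have "normal_plane X u v \<subseteq> span {N 1, N 2}"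
    by (intro card_ge_dim_independent) (simp_all add: dim_normal_plane[OF W])
  then have "n \<in> span {N 1, N 2}"
    using n by (auto simp: mem_normal_plane_iff)
  then obtain p q where "n = p *\<^sub>R N 1 + q *\<^sub>R N 2"
    by (auto simp: span_insert span_singleton algebra_simps)
  then show ?thesis
    by (simp add: sum_2 inner_add_left inner_add_right ip inner_commute[of _ w])
qed

section \<open>Curves\<close>

lemma smooth_curve_onD:
  assumes "smooth_curve_on S f" "t \<in> S"
  shows "(f has_vector_derivative vector_derivative f (at t)) (at t)"
    and "((\<lambda>s. vector_derivative f (at s)) has_vector_derivative
           vector_derivative (\<lambda>s. vector_derivative f (at s)) (at t)) (at t)"
proof -
  have D: "((\<lambda>g s. vector_derivative g (at s)) ^^ n) f differentiable (at t)" for n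
    using assms by (simp add: smooth_curve_on_def)
  show "(f has_vector_derivative vector_derivative f (at t)) (at t)"
    using D[of 0] by (simp add: vector_derivative_works)
  show "((\<lambda>s. vector_derivative f (at s)) has_vector_derivative
           vector_derivative (\<lambda>s. vector_derivative f (at s)) (at t)) (at t)"
    using D[of 1] by (simp add: vector_derivative_works)
qed

lemma inner_constant_derivative:
  fixes f g :: "real \<Rightarrow> 'a::real_inner"
  assumes "(f has_vector_derivative f') (at t)" "(g has_vector_derivative g') (at t)"
    and "open S" "t \<in> S" "\<And>s. s \<in> S \<Longrightarrow> f s \<bullet> g s = k"
  shows "f t \<bullet> g' + f' \<bullet> g t = 0"
proof -
  have "((\<lambda>s. f s \<bullet> g s) has_vector_derivative (f t \<bullet> g' + f' \<bullet> g t)) (at t)"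
    by (rule bounded_bilinear.has_vector_derivative[OF bounded_bilinear_inner assms(1,2)])
  moreover have "((\<lambda>s. f s \<bullet> g s) has_vector_derivative 0) (at t)"
    by (rule has_vector_derivative_transform_within_open[of "\<lambda>_. k" 0 t S]) (use assms in auto)
  ultimately show ?thesis
    by (rule vector_derivative_unique_at)
qed

section \<open>Meridian surfaces over a unit speed profile\<close>

text \<open>
  In the conclusion, \<open>\<phi>' * f'' - f' * \<phi>''\<close> is the signed curvature of the profile
  \<open>(f, \<phi>)\<close>; it enters through \<open>X\<^sub>u\<^sub>u\<close>, which is that multiple of the unit normal \<open>n\<close>.
\<close>
lemma gaussian_curvature_unit_speed_meridian:
  fixes f \<phi> f' \<phi>' :: "real \<Rightarrow> real" and f'' \<phi>'' :: real
    and \<rho> \<rho>' :: "real \<Rightarrow> real^4" and \<rho>'' e :: "real^4"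
  defines "X \<equiv> \<lambda>u v. \<phi> u *\<^sub>R e + f u *\<^sub>R \<rho> v"
  assumes I: "open I" "u \<in> I" and J: "open J" "v \<in> J"
    and f: "\<And>u. u \<in> I \<Longrightarrow> (f has_real_derivative f' u) (at u)"
      "(f' has_real_derivative f'') (at u)"
    and \<phi>: "\<And>u. u \<in> I \<Longrightarrow> (\<phi> has_real_derivative \<phi>' u) (at u)"
      "(\<phi>' has_real_derivative \<phi>'') (at u)"
    and unit_speed: "\<And>u. u \<in> I \<Longrightarrow> (f' u)\<^sup>2 + (\<phi>' u)\<^sup>2 = 1"
    and "f u \<noteq> 0"
    and \<rho>: "\<And>v. v \<in> J \<Longrightarrow> (\<rho> has_vector_derivative \<rho>' v) (at v)"
      "(\<rho>' has_vector_derivative \<rho>'') (at v)"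
    and e: "e \<bullet> e = 1" "\<And>v. v \<in> J \<Longrightarrow> e \<bullet> \<rho> v = 0"
    and sphere: "\<And>v. v \<in> J \<Longrightarrow> \<rho> v \<bullet> \<rho> v = 1" "\<And>v. v \<in> J \<Longrightarrow> \<rho>' v \<bullet> \<rho>' v = 1"
  shows "has_gaussian_curvature_at X (- ((\<phi>' u * f'' - f' u * \<phi>'') * \<phi>' u) / f u) u v"
proof -
  define \<kappa> where "\<kappa> = \<phi>' u * f'' - f' u * \<phi>''"
  define n where "n = \<phi>' u *\<^sub>R \<rho> v - f' u *\<^sub>R e"

  have \<rho>_\<rho>': "\<rho> t \<bullet> \<rho>' t = 0" if "t \<in> J" for t
    using inner_constant_derivative[OF \<rho>(1) \<rho>(1) J(1) that sphere(1)] that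
    by (simp add: inner_commute)
  have e_\<rho>': "e \<bullet> \<rho>' t = 0" if "t \<in> J" for t
    using inner_constant_derivative[OF has_vector_derivative_const \<rho>(1) J(1) that e(2)] that
    by simp
  have \<rho>_\<rho>'': "\<rho> v \<bullet> \<rho>'' = - 1"
    using inner_constant_derivative[OF \<rho>(1) \<rho>(2) J \<rho>_\<rho>'] J sphere(2) by simp
  have e_\<rho>'': "e \<bullet> \<rho>'' = 0"
    using inner_constant_derivative[OF has_vector_derivative_const \<rho>(2) J e_\<rho>'] by simp

  have Xu: "partial_u X s t = \<phi>' s *\<^sub>R e + f' s *\<^sub>R \<rho> t" if "s \<in> I" for s t
    unfolding partial_u_def X_def
    by (rule vector_derivative_at) (auto intro!: derivative_eq_intros f \<phi> that)
  have Xv: "partial_v X s t = f s *\<^sub>R \<rho>' t" if "t \<in> J" for s t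
    unfolding partial_v_def X_def
    by (rule vector_derivative_at) (auto intro!: derivative_eq_intros \<rho> that)
  have Xuu: "partial_u (partial_u X) u v = \<phi>'' *\<^sub>R e + f'' *\<^sub>R \<rho> v"
    unfolding partial_u_def[of "partial_u X"]
  proof (rule vector_derivative_at, rule has_vector_derivative_transform_within_open[OF _ I])
    show "((\<lambda>s. \<phi>' s *\<^sub>R e + f' s *\<^sub>R \<rho> v) has_vector_derivative \<phi>'' *\<^sub>R e + f'' *\<^sub>R \<rho> v) (at u)"
      by (auto intro!: derivative_eq_intros f \<phi>)
  qed (simp add: Xu)
  have Xuv: "partial_v (partial_u X) u v = f' u *\<^sub>R \<rho>' v"
    unfolding partial_v_def Xu[OF I(2)]
    by (rule vector_derivative_at) (auto intro!: derivative_eq_intros \<rho> J)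
  have Xvv: "partial_v (partial_v X) u v = f u *\<^sub>R \<rho>''"
    unfolding partial_v_def[of "partial_v X"]
  proof (rule vector_derivative_at, rule has_vector_derivative_transform_within_open[OF _ J])
    show "((\<lambda>t. f u *\<^sub>R \<rho>' t) has_vector_derivative f u *\<^sub>R \<rho>'') (at v)"
      by (auto intro!: derivative_eq_intros \<rho>)
  qed (simp add: Xv)

  have ip: "\<rho> v \<bullet> e = 0" "\<rho>' v \<bullet> e = 0" "\<rho>' v \<bullet> \<rho> v = 0"
    using e_\<rho>' \<rho>_\<rho>' e J by (simp_all add: inner_commute)
  have speed: "\<phi>' u * \<phi>' u + f' u * f' u = 1"
    using unit_speed[OF I(2)] by (simp add: power2_eq_square)
  have W: "W_squared X u v = (f u)\<^sup>2"
    using speed ip e sphere e_\<rho>' \<rho>_\<rho>' J I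
    by (simp add: W_squared_def g11_def g12_def g22_def Xu Xv inner_add_left inner_add_right
        power2_eq_square)
  then have W0: "W_squared X u v \<noteq> 0"
    using \<open>f u \<noteq> 0\<close> by simp
  have n_normal: "partial_u X u v \<bullet> n = 0" "partial_v X u v \<bullet> n = 0"
    using ip e sphere J I
    by (simp_all add: Xu Xv n_def inner_add_left inner_diff_right)

  \<comment> \<open>The acceleration of a unit speed curve is orthogonal to its velocity, here in the
    plane spanned by \<open>e\<close> and \<open>\<rho> v\<close>; so it is a multiple of \<open>n\<close>.\<close>
  have acceleration: "f' u * f'' + \<phi>' u * \<phi>'' = 0"
  proof -
    have "((\<lambda>s. (f' s)\<^sup>2 + (\<phi>' s)\<^sup>2) has_real_derivative 2 * (f' u * f'' + \<phi>' u * \<phi>'')) (at u)"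
      by (auto intro!: derivative_eq_intros f \<phi>)
    moreover have "((\<lambda>s. (f' s)\<^sup>2 + (\<phi>' s)\<^sup>2) has_real_derivative 0) (at u)"
      by (rule has_field_derivative_transform_within_open[of "\<lambda>_. 1" 0 u I])
        (use I unit_speed in auto)
    ultimately show ?thesis
      using DERIV_unique by fastforce
  qed
  have "\<phi>'' = - (\<kappa> * f' u)" "f'' = \<kappa> * \<phi>' u"
    unfolding \<kappa>_def using speed acceleration by algebra+
  then have Xuu': "partial_u (partial_u X) u v = \<kappa> *\<^sub>R n"
    by (simp add: Xuu n_def algebra_simps)

  have "- (\<kappa> * \<phi>' u) / f u = 1 / W_squared X u v *
      (\<Sum>k\<in>UNIV. L11 X (N k) u v * L22 X (N k) u v - (L12 X (N k) u v)\<^sup>2)"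
    if N: "orthonormal_normal_frame X u v N" for N
  proof -
    have "L12 X (N k) u v = 0" for k
      using N \<open>f u \<noteq> 0\<close> J by (simp add: L12_def Xuv orthonormal_normal_frame_def Xv)
    then have "(\<Sum>k\<in>UNIV. L11 X (N k) u v * L22 X (N k) u v - (L12 X (N k) u v)\<^sup>2)
        = \<kappa> * (\<Sum>k\<in>UNIV. (n \<bullet> N k) * (f u *\<^sub>R \<rho>'' \<bullet> N k))"
      by (simp add: L11_def L22_def Xuu' Xvv sum_distrib_left mult_ac)
    also have "\<dots> = \<kappa> * (n \<bullet> (f u *\<^sub>R \<rho>''))"
      by (simp only: orthonormal_normal_frame_parseval[OF W0 N n_normal])
    also have "\<dots> = - \<kappa> * \<phi>' u * f u"
      using \<rho>_\<rho>'' e_\<rho>'' by (simp add: n_def inner_diff_left)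
    finally show ?thesis
      using \<open>f u \<noteq> 0\<close> by (simp add: W power2_eq_square)
  qed
  then show ?thesis
    unfolding has_gaussian_curvature_at_def \<kappa>_def
    using W0 orthonormal_normal_frame_exists[OF W0] by blast
qed

theorem proposition12:
  fixes c lam :: real and I J :: "real set"
    and \<phi> :: "real \<Rightarrow> real" and \<rho> :: "real \<Rightarrow> real^4"
  assumes "c \<noteq> 0" and "lam > 0"
    and "open I" and "is_interval I"
    and "\<And>u. u \<in> I \<Longrightarrow> cos (u / c) \<noteq> 0"
    and "\<And>u. u \<in> I \<Longrightarrow> 1 - lam\<^sup>2 / c\<^sup>2 * (sin (u / c))\<^sup>2 > 0"
    and "open J" and "is_interval J"
    and "smooth_curve_on J \<rho>"
    and "\<And>v. v \<in> J \<Longrightarrow> \<rho> v \<in> sphere 0 1 \<inter> span {axis 2 1, axis 3 1, axis 4 1}"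
    and "\<And>v. v \<in> J \<Longrightarrow> norm (vector_derivative \<rho> (at v)) = 1"
    and "\<And>u. u \<in> I \<Longrightarrow>
           (\<phi> has_real_derivative sqrt (1 - lam\<^sup>2 / c\<^sup>2 * (sin (u / c))\<^sup>2)) (at u)"
  shows "\<forall>u\<in>I. \<forall>v\<in>J.
           has_gaussian_curvature_at (meridian_surface c lam \<phi> \<rho>)
             (- (kappa_gamma c lam \<phi> u * deriv \<phi> u) / (lam * cos (u / c))) u v"
proof (intro ballI)
  fix u v assume u: "u \<in> I" and v: "v \<in> J"
  let ?s = "\<lambda>u. sqrt (1 - lam\<^sup>2 / c\<^sup>2 * (sin (u / c))\<^sup>2)"
  have deriv_\<phi>: "deriv \<phi> t = ?s t" if "t \<in> I" for t
    using assms(12)[OF that] by (rule DERIV_imp_deriv)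
  obtain s' where s': "(?s has_real_derivative s') (at u)"
  proof
    show "(?s has_real_derivative
        - (lam\<^sup>2 / c\<^sup>2 * (2 * sin (u / c) * (cos (u / c) / c))) * (inverse (?s u) / 2)) (at u)"
      using assms(1) assms(6)[OF u]
      by (auto intro!: derivative_eq_intros simp: field_simps)
  qed
  have deriv2_\<phi>: "(deriv \<phi> has_real_derivative deriv (deriv \<phi>) u) (at u)"
  proof -
    have "(deriv \<phi> has_real_derivative s') (at u)"
      by (rule has_field_derivative_transform_within_open[OF s' \<open>open I\<close> u]) (simp add: deriv_\<phi>)
    then show ?thesis
      using DERIV_imp_deriv by metis
  qed
  have "axis 1 1 \<bullet> \<rho> t = 0" if "t \<in> J" for t
  proof -
    have "orthogonal (axis 1 1) (\<rho> t)"
      by (rule orthogonal_to_span[where S = "{axis 2 1, axis 3 1, axis 4 1}"])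
        (use assms(10)[OF that] in \<open>auto simp: orthogonal_def inner_axis_axis\<close>)
    then show ?thesis
      by (simp add: orthogonal_def)
  qed
  then have "has_gaussian_curvature_at (\<lambda>u v. \<phi> u *\<^sub>R axis 1 1 + (lam * cos (u / c)) *\<^sub>R \<rho> v)
      (- ((deriv \<phi> u * (- (lam / c\<^sup>2) * cos (u / c)) - - (lam / c) * sin (u / c) * deriv (deriv \<phi>) u)
          * deriv \<phi> u) / (lam * cos (u / c))) u v"
  proof (intro gaussian_curvature_unit_speed_meridian[where I = I and J = J
        and f' = "\<lambda>u. - (lam / c) * sin (u / c)" and \<rho>' = "\<lambda>v. vector_derivative \<rho> (at v)"
        and \<rho>'' = "vector_derivative (\<lambda>s. vector_derivative \<rho> (at s)) (at v)"]
      \<open>open I\<close> \<open>open J\<close> u v deriv2_\<phi> smooth_curve_onD[OF assms(9)])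
    show "((\<lambda>u. lam * cos (u / c)) has_real_derivative - (lam / c) * sin (t / c)) (at t)" for t
      using assms(1) by (auto intro!: derivative_eq_intros)
    show "((\<lambda>u. - (lam / c) * sin (u / c)) has_real_derivative - (lam / c\<^sup>2) * cos (u / c)) (at u)"
      using assms(1) by (auto intro!: derivative_eq_intros simp: power2_eq_square)
    show "(\<phi> has_real_derivative deriv \<phi> t) (at t)" if "t \<in> I" for t
      using assms(12) deriv_\<phi> that by simp
    show "(- (lam / c) * sin (t / c))\<^sup>2 + (deriv \<phi> t)\<^sup>2 = 1" if "t \<in> I" for t
      using assms(6)[OF that] by (simp add: deriv_\<phi>[OF that] power_mult_distrib power_divide)
    show "lam * cos (u / c) \<noteq> 0"
      using assms(2,5) u by simp
    show "\<rho> t \<bullet> \<rho> t = 1" if "t \<in> J" for t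
      using assms(10)[OF that] by (simp add: norm_eq_1)
    show "vector_derivative \<rho> (at t) \<bullet> vector_derivative \<rho> (at t) = 1" if "t \<in> J" for t
      using assms(11)[OF that] by (simp add: norm_eq_1)
  qed (auto simp: inner_axis_axis)
  then show "has_gaussian_curvature_at (meridian_surface c lam \<phi> \<rho>)
      (- (kappa_gamma c lam \<phi> u * deriv \<phi> u) / (lam * cos (u / c))) u v"
    by (simp add: meridian_surface_def[abs_def] kappa_gamma_def algebra_simps)
qed

end
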